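(* Let $G$ be a finite almost simple group. Then $$\mathcal{H}_1(G) = \{\lambda(G),\rho(G)\},$$ that is, the normal subgroups of $\mathrm{Hol}(G)$ which are regular as subgroups of $\mathrm{Perm}(G)$ are exactly $\lambda(G)$ and $\rho(G)$. In particular, $$\mathcal{H}_0(G) = \{\lambda(G),\rho(G)\}\quad\text{and}\quad T(G)\simeq \mathbb{Z}/2\mathbb{Z}.$$
   Context: A group $G$ is almost simple if $\mathrm{Inn}(T)\leq G\leq \mathrm{Aut}(T)$ for some non-abelian simple group $T$, where $\mathrm{Inn}(T)$ is the inner automorphism group of $T$. For a group $G$, $\mathrm{Perm}(G)$ is the symmetric group on the set $G$. The left and right regular representations $\lambda,\rho:G\to\mathrm{Perm}(G)$ are $\lambda(\sigma)=(x\mapsto\sigma x)$ and $\rho(\sigma)=(x\mapsto x\sigma^{-1})$. A subgroup $N$ of $\mathrm{Perm}(G)$ is regular if the map $N\to G$, $\eta\mapsto\eta(1_G)$, is bijective (equivalently, the action of $N$ on $G$ is transitive and free). The holomorph of $G$ is $\mathrm{Hol}(G)=\rho(G)\rtimes\mathrm{Aut}(G)\leq\mathrm{Perm}(G)$, which equals the normalizer in $\mathrm{Perm}(G)$ of $\lambda(G)$, and also that of $\rho(G)$. The multiple holomorph of $G$ is $\mathrm{NHol}(G)$, the normalizer of $\mathrm{Hol}(G)$ in $\mathrm{Perm}(G)$, and $T(G)=\mathrm{NHol}(G)/\mathrm{Hol}(G)$. Let $\mathcal{H}_0(G)$ be the set of regular subgroups $N$ of $\mathrm{Perm}(G)$ that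 are isomorphic to $G$ and whose normalizer in $\mathrm{Perm}(G)$ equals $\mathrm{Hol}(G)$. Let $\mathcal{H}_1(G)$ be the set of normal and regular subgroups of $\mathrm{Hol}(G)$ (i.e. normal subgroups of $\mathrm{Hol}(G)$ that are regular in $\mathrm{Perm}(G)$). *)

theory Defs
  imports "HOL-Algebra.Algebra"
begin

definition Inn :: "('a, 'b) monoid_scheme \<Rightarrow> ('a \<Rightarrow> 'a) set" where
  "Inn G = (\<lambda>g. \<lambda>x\<in>carrier G. g \<otimes>\<^bsub>G\<^esub> x \<otimes>\<^bsub>G\<^esub> inv\<^bsub>G\<^esub> g) ` carrier G"

text \<open>A group is almost simple if it is, up to isomorphism, a group between \<open>Inn T\<close> and
  \<open>Aut T\<close> for some non-abelian simple group \<open>T\<close>. The group \<open>T\<close> is a parameter because a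
  definition cannot quantify existentially over its element type; a theorem that assumes
  \<open>almost_simple_over T G\<close> for an arbitrary \<open>T\<close> is a theorem about all almost simple \<open>G\<close>.

  The library's \<^const>\<open>simple_group\<close> asks for \<open>order T > 1\<close> and thus excludes infinite \<open>T\<close>
  (\<open>order\<close> is a \<open>card\<close>). For finite \<open>G\<close> this excludes nothing: a non-abelian simple \<open>T\<close> has
  trivial centre, so it is isomorphic to \<open>Inn T\<close> and embeds into \<open>G\<close>.\<close>

definition almost_simple_over ::
    "('b, 'd) monoid_scheme \<Rightarrow> ('a, 'c) monoid_scheme \<Rightarrow> bool" where
  "almost_simple_over T G \<longleftrightarrow>
     group G \<and> simple_group T \<and> \<not> comm_group T \<and>
     (\<exists>K. subgroup K (AutoGroup T) \<and> Inn T \<subseteq> K \<and> G \<cong> AutoGroup T\<lparr>carrier := K\<rparr>)"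

text \<open>Permutations of the set \<open>carrier G\<close> are represented extensionally (\<open>undefined\<close> outside
  the carrier), as in \<^const>\<open>BijGroup\<close> and \<^const>\<open>auto\<close>.\<close>

abbreviation Perm :: "('a, 'b) monoid_scheme \<Rightarrow> ('a \<Rightarrow> 'a) monoid" where
  "Perm G \<equiv> BijGroup (carrier G)"

definition left_reg :: "('a, 'b) monoid_scheme \<Rightarrow> 'a \<Rightarrow> 'a \<Rightarrow> 'a" where
  "left_reg G \<sigma> = (\<lambda>x\<in>carrier G. \<sigma> \<otimes>\<^bsub>G\<^esub> x)"

definition right_reg :: "('a, 'b) monoid_scheme \<Rightarrow> 'a \<Rightarrow> 'a \<Rightarrow> 'a" where
  "right_reg G \<sigma> = (\<lambda>x\<in>carrier G. x \<otimes>\<^bsub>G\<^esub> inv\<^bsub>G\<^esub> \<sigma>)"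

definition regular_subgroup :: "('a \<Rightarrow> 'a) set \<Rightarrow> ('a, 'b) monoid_scheme \<Rightarrow> bool" where
  "regular_subgroup N G \<longleftrightarrow>
     subgroup N (Perm G) \<and> bij_betw (\<lambda>\<eta>. \<eta> \<one>\<^bsub>G\<^esub>) N (carrier G)"

text \<open>The holomorph is the inner semidirect product of \<open>\<rho>(G)\<close> and \<open>Aut G\<close> in \<open>Perm G\<close>. As a
  subset of \<open>Perm G\<close> this is the product set; that \<open>\<rho>(G)\<close> is normalized by \<open>Aut G\<close> and meets
  it trivially is automatic.\<close>

definition Hol :: "('a, 'b) monoid_scheme \<Rightarrow> ('a \<Rightarrow> 'a) set" where
  "Hol G = (right_reg G ` carrier G) <#>\<^bsub>Perm G\<^esub> auto G"

definition NHol :: "('a, 'b) monoid_scheme \<Rightarrow> ('a \<Rightarrow> 'a) set" where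
  "NHol G = normalizer (Perm G) (Hol G)"

definition T_group :: "('a, 'b) monoid_scheme \<Rightarrow> ('a \<Rightarrow> 'a) set monoid" where
  "T_group G = (Perm G)\<lparr>carrier := NHol G\<rparr> Mod Hol G"

definition H0 :: "('a, 'b) monoid_scheme \<Rightarrow> ('a \<Rightarrow> 'a) set set" where
  "H0 G = {N. regular_subgroup N G \<and> (Perm G)\<lparr>carrier := N\<rparr> \<cong> G \<and>
              normalizer (Perm G) N = Hol G}"

definition H1 :: "('a, 'b) monoid_scheme \<Rightarrow> ('a \<Rightarrow> 'a) set set" where
  "H1 G = {N. N \<lhd> (Perm G)\<lparr>carrier := Hol G\<rparr> \<and> regular_subgroup N G}"

end

theory Submission
  imports Defs
begin

text \<open>Write \<open>L = \<lambda>(G)\<close> and \<open>R = \<rho>(G)\<close>. Two facts about \<open>G\<close> carry the proof: its centre is trivial,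
  and any two nontrivial normal subgroups of \<open>G\<close> share a nontrivial element, because each of them
  contains the copy of \<open>T\<close> in \<open>G\<close> (\<open>almost_simple_meeting_normals\<close>).

  Let \<open>N\<close> be a regular normal subgroup of \<open>Hol G\<close>. The subgroups \<open>L\<close> and \<open>R\<close> are also normal
  in \<open>Hol G\<close>, and they are each other's centralizers in \<open>Perm G\<close>. If \<open>N \<inter> L\<close> is trivial, then
  \<open>N\<close> and \<open>L\<close> commute elementwise, so \<open>N \<subseteq> R\<close>, and two nested regular groups coincide; likewise
  \<open>N = L\<close> if \<open>N \<inter> R\<close> is trivial. Otherwise the normal subgroups of \<open>G\<close> that \<open>\<lambda>\<close> and \<open>\<rho>\<close> map
  into \<open>N\<close> are both nontrivial and hence share some \<open>s \<noteq> 1\<close>. Then \<open>\<lambda>(s)\<close> and \<open>\<rho>(s\<inverse>)\<close> are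
  elements of \<open>N\<close> that both send \<open>1\<close> to \<open>s\<close>; as \<open>N\<close> is regular they are equal, which says that
  \<open>s\<close> is central, a contradiction (\<open>normal_regular_subgroup_cases\<close>).

  The remaining claims follow once \<open>Hol G\<close> is known to be the normalizer of both \<open>L\<close> and \<open>R\<close>.
  This rests on a description of \<open>Hol G\<close> by one identity, \<open>f(xy) = f(x) f(1)\<inverse> f(y)\<close>
  (\<open>Hol_iff\<close>), and on the fact that a normalizer of a subgroup also normalizes its centralizer.
  A subgroup is normal in its normalizer, so \<open>H0 G \<subseteq> H1 G\<close>. Conjugation by an element of
  \<open>NHol G\<close> permutes \<open>H1 G = {L, R}\<close>, and by the normalizer computation the elements that fix \<open>L\<close>
  are those of \<open>Hol G\<close>. The product of two elements of \<open>NHol G\<close> outside \<open>Hol G\<close> thus lies in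
  \<open>Hol G\<close>. Inversion \<open>x \<mapsto> x\<inverse>\<close> lies in \<open>NHol G\<close> but not in \<open>Hol G\<close>, as \<open>G\<close> is not abelian,
  and so \<open>Hol G\<close> has index two.\<close>

section \<open>Normalizers, centralizers and subgroups of index two\<close>

definition centralizer :: "('a, 'b) monoid_scheme \<Rightarrow> 'a set \<Rightarrow> 'a set" where
  "centralizer G N = {c \<in> carrier G. \<forall>n\<in>N. c \<otimes>\<^bsub>G\<^esub> n = n \<otimes>\<^bsub>G\<^esub> c}"

context group
begin

lemma cancel_left:
  assumes "x \<in> carrier G" "y \<in> carrier G"
  shows "inv x \<otimes> (x \<otimes> y) = y" "x \<otimes> (inv x \<otimes> y) = y"
  using assms by (simp_all add: m_assoc[symmetric])

lemmas group_word_simps = m_assoc inv_mult_group cancel_left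

lemma eq_conjugate_iff:
  assumes "g \<in> carrier G" "n \<in> carrier G" "m \<in> carrier G"
  shows "g \<otimes> n \<otimes> inv g = m \<longleftrightarrow> g \<otimes> n = m \<otimes> g"
  using assms by (metis inv_closed inv_solve_right m_closed)

lemma conjugate_set_eq: "g <# N #> inv g = (\<lambda>n. g \<otimes> n \<otimes> inv g) ` N"
  by (auto simp: l_coset_def r_coset_def)

lemma normalizer_iff_conjugate_set:
  assumes "N \<subseteq> carrier G"
  shows "g \<in> normalizer G N \<longleftrightarrow> g \<in> carrier G \<and> g <# N #> inv g = N"
  using assms by (auto simp: normalizer_def stabilizer_def)

text \<open>The library's normalizer asks for \<open>g N g\<inverse> = N\<close>. Inclusion alone would not do
  when \<open>N\<close> is infinite, which is why the condition appears for both \<open>g\<close> and \<open>g\<inverse>\<close>.\<close>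

lemma normalizer_iff_conjugates:
  assumes N: "N \<subseteq> carrier G"
  shows "g \<in> normalizer G N \<longleftrightarrow>
    g \<in> carrier G \<and> (\<forall>n\<in>N. g \<otimes> n \<otimes> inv g \<in> N) \<and> (\<forall>n\<in>N. inv g \<otimes> n \<otimes> g \<in> N)"
proof -
  have "N \<subseteq> (\<lambda>n. g \<otimes> n \<otimes> inv g) ` N \<longleftrightarrow> (\<forall>n\<in>N. inv g \<otimes> n \<otimes> g \<in> N)"
    if g: "g \<in> carrier G"
  proof -
    have "n \<in> (\<lambda>n. g \<otimes> n \<otimes> inv g) ` N \<longleftrightarrow> inv g \<otimes> n \<otimes> g \<in> N" if n: "n \<in> N" for n
    proof
      assume "n \<in> (\<lambda>n. g \<otimes> n \<otimes> inv g) ` N"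
      then obtain m where "m \<in> N" "n = g \<otimes> m \<otimes> inv g" by blast
      moreover have "inv g \<otimes> (g \<otimes> m \<otimes> inv g) \<otimes> g = m"
        using g N \<open>m \<in> N\<close> by (simp add: subset_eq group_word_simps)
      ultimately show "inv g \<otimes> n \<otimes> g \<in> N" by simp
    next
      assume "inv g \<otimes> n \<otimes> g \<in> N"
      moreover have "n = g \<otimes> (inv g \<otimes> n \<otimes> g) \<otimes> inv g"
        using g N n by (simp add: subset_eq group_word_simps)
      ultimately show "n \<in> (\<lambda>n. g \<otimes> n \<otimes> inv g) ` N" by blast
    qed
    then show ?thesis by blast
  qed
  then show ?thesis
    unfolding normalizer_iff_conjugate_set[OF N] conjugate_set_eq by blast
qed

lemma centralizer_subset: "centralizer G N \<subseteq> carrier G"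
  by (auto simp: centralizer_def)

text \<open>Conjugation by \<open>g\<close> is an automorphism; if it preserves \<open>N\<close>, it preserves everything defined
  from \<open>N\<close>. Two subgroups that are each other's centralizers therefore have the same normalizer.\<close>

lemma normalizer_subset_normalizer_centralizer:
  assumes N: "N \<subseteq> carrier G"
  shows "normalizer G N \<subseteq> normalizer G (centralizer G N)"
proof -
  have conj: "g \<otimes> c \<otimes> inv g \<in> centralizer G N"
    if g: "g \<in> carrier G" and stable: "\<forall>n\<in>N. inv g \<otimes> n \<otimes> g \<in> N" and c: "c \<in> centralizer G N" for g c
  proof -
    have cG: "c \<in> carrier G" using c by (simp add: centralizer_def)
    have "g \<otimes> c \<otimes> inv g \<otimes> n = n \<otimes> (g \<otimes> c \<otimes> inv g)" if n: "n \<in> N" for n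
    proof -
      have nG: "n \<in> carrier G" using N n by blast
      have eq: "c \<otimes> (inv g \<otimes> n \<otimes> g) = (inv g \<otimes> n \<otimes> g) \<otimes> c"
        using stable c n unfolding centralizer_def by blast
      have "g \<otimes> c \<otimes> inv g \<otimes> n = g \<otimes> (c \<otimes> (inv g \<otimes> n \<otimes> g)) \<otimes> inv g"
        using g nG cG by (simp add: group_word_simps)
      also have "\<dots> = n \<otimes> (g \<otimes> c \<otimes> inv g)"
        unfolding eq using g nG cG
        by (simp add: group_word_simps)
      finally show ?thesis .
    qed
    then show ?thesis using g cG by (simp add: centralizer_def)
  qed
  show ?thesis
  proof
    fix g assume "g \<in> normalizer G N"
    then have g: "g \<in> carrier G" "\<forall>n\<in>N. g \<otimes> n \<otimes> inv g \<in> N" "\<forall>n\<in>N. inv g \<otimes> n \<otimes> g \<in> N"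
      by (auto simp: normalizer_iff_conjugates[OF N])
    then show "g \<in> normalizer G (centralizer G N)"
      using conj[of g] conj[of "inv g"]
      by (simp add: normalizer_iff_conjugates[OF centralizer_subset])
  qed
qed

text \<open>Conjugation by \<open>g\<close> restricts to an automorphism of \<open>H\<close>, hence permutes the normal subgroups
  of \<open>H\<close>. Concretely, \<open>h\<close> acts on \<open>g N g\<inverse>\<close> the way \<open>g\<inverse> h g\<close>, again an element of \<open>H\<close>, acts on \<open>N\<close>.\<close>

lemma normal_in_conjugate:
  assumes H: "subgroup H G" and N: "N \<lhd> G\<lparr>carrier := H\<rparr>" and g: "g \<in> normalizer G H"
  shows "g <# N #> inv g \<lhd> G\<lparr>carrier := H\<rparr>"
proof -
  have HG: "H \<subseteq> carrier G" using H by (rule subgroup.subset)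
  have NH: "N \<subseteq> H" using normal_imp_subgroup[OF N] subgroup.subset by fastforce
  have NG: "N \<subseteq> carrier G" using NH HG by blast
  have subN: "subgroup N G"
    using normal_imp_subgroup[OF N] H incl_subgroup by blast
  have gG: "g \<in> carrier G" using g HG normalizer_iff_conjugates by blast
  interpret H: group "G\<lparr>carrier := H\<rparr>"
    using H by (rule subgroup_imp_group)
  have N': "h \<otimes> n \<otimes> inv h \<in> N" if "h \<in> H" "n \<in> N" for h n
    using H.normal_invE(2)[OF N, of h n] that by (simp add: m_inv_consistent[OF H])
  have sub: "subgroup (g <# N #> inv g) G"
    using gG subN by (rule subgroup_conjugation_is_surj2)
  have HH: "g \<otimes> h \<otimes> inv g \<in> H" "inv g \<otimes> h \<otimes> g \<in> H" if "h \<in> H" for h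
    using g that by (auto simp: normalizer_iff_conjugates[OF HG])
  have sub_H: "g <# N #> inv g \<subseteq> H"
    using HH NH by (auto simp: conjugate_set_eq)
  show ?thesis
  proof (rule H.normal_invI)
    show "subgroup (g <# N #> inv g) (G\<lparr>carrier := H\<rparr>)"
      using H sub sub_H by (simp add: subgroup_incl)
    fix m h
    assume "h \<in> carrier (G\<lparr>carrier := H\<rparr>)" and m: "m \<in> g <# N #> inv g"
    then have h: "h \<in> H" and hG: "h \<in> carrier G" using HG by auto
    from m obtain n where n: "n \<in> N" "m = g \<otimes> n \<otimes> inv g" and nG: "n \<in> carrier G"
      using NG by (auto simp: conjugate_set_eq)
    define k where "k = inv g \<otimes> h \<otimes> g"
    have k: "k \<in> H" "k \<in> carrier G" using HH[OF h] HG by (auto simp: k_def)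
    have hg: "h \<otimes> g = g \<otimes> k"
      using gG hG by (simp add: k_def group_word_simps)
    have "h \<otimes> m \<otimes> inv h = (h \<otimes> g) \<otimes> n \<otimes> inv (h \<otimes> g)"
      using gG hG nG by (simp add: n group_word_simps)
    also have "\<dots> = g \<otimes> (k \<otimes> n \<otimes> inv k) \<otimes> inv g"
      unfolding hg using gG k nG by (simp add: group_word_simps)
    also have "\<dots> \<in> g <# N #> inv g"
      using N'[OF k(1) n(1)] by (auto simp: conjugate_set_eq)
    finally show "h \<otimes>\<^bsub>G\<lparr>carrier := H\<rparr>\<^esub> m \<otimes>\<^bsub>G\<lparr>carrier := H\<rparr>\<^esub> inv\<^bsub>G\<lparr>carrier := H\<rparr>\<^esub> h
        \<in> g <# N #> inv g"
      using h by (simp add: m_inv_consistent[OF H])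
  qed
qed

lemma conjugate_set_mult:
  assumes "x \<in> carrier G" "y \<in> carrier G" "N \<subseteq> carrier G"
  shows "(x \<otimes> y) <# N #> inv (x \<otimes> y) = x <# (y <# N #> inv y) #> inv x"
  unfolding conjugate_set_eq image_image using assms
  by (intro image_cong) (auto simp: group_word_simps subset_eq)

text \<open>The commutator of \<open>n\<close> and \<open>m\<close> lies in both subgroups.\<close>

lemma disjoint_normals_commute:
  assumes N: "N \<lhd> G" and M: "M \<lhd> G" and disj: "N \<inter> M = {\<one>}"
    and n: "n \<in> N" and m: "m \<in> M"
  shows "n \<otimes> m = m \<otimes> n"
proof -
  have nG: "n \<in> carrier G" and mG: "m \<in> carrier G"
    using assms normal_imp_subgroup subgroup.subset by blast+
  have "n \<otimes> (m \<otimes> inv n \<otimes> inv m) \<in> N"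
    using n mG normal_invE[OF N] by (simp add: subgroup.m_closed subgroup.m_inv_closed)
  moreover have "n \<otimes> m \<otimes> inv n \<otimes> inv m \<in> M"
    using m nG normal_invE[OF M] by (simp add: subgroup.m_closed subgroup.m_inv_closed)
  ultimately have "n \<otimes> m \<otimes> inv n \<otimes> inv m = \<one>"
    using disj nG mG by (auto simp: m_assoc)
  moreover have "n \<otimes> m = n \<otimes> m \<otimes> inv n \<otimes> inv m \<otimes> (m \<otimes> n)"
    using nG mG by (simp add: group_word_simps)
  ultimately show ?thesis using nG mG by simp
qed

text \<open>The indicator of the complement of \<open>N\<close> is a homomorphism onto \<open>\<int>/2\<int>\<close> with kernel \<open>N\<close>; the
  hypothesis on products is the case \<open>1 + 1 = 0\<close>.\<close>

lemma quotient_iso_integer_mod_2: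
  assumes N: "subgroup N G" and t: "t \<in> carrier G" "t \<notin> N"
    and mult: "\<And>x y. \<lbrakk>x \<in> carrier G - N; y \<in> carrier G - N\<rbrakk> \<Longrightarrow> x \<otimes> y \<in> N"
  shows "G Mod N \<cong> integer_mod_group 2"
proof -
  define \<chi> where "\<chi> x = (if x \<in> N then 0 else 1 :: int)" for x
  have NG: "N \<subseteq> carrier G" using N by (rule subgroup.subset)
  have mixed: "x \<otimes> y \<in> N \<longleftrightarrow> y \<in> N" "y \<otimes> x \<in> N \<longleftrightarrow> y \<in> N"
    if x: "x \<in> N" and y: "y \<in> carrier G" for x y
  proof -
    have "y = inv x \<otimes> (x \<otimes> y)" "y = (y \<otimes> x) \<otimes> inv x"
      using x y NG by (simp_all add: subset_eq group_word_simps)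
    then show "x \<otimes> y \<in> N \<longleftrightarrow> y \<in> N" "y \<otimes> x \<in> N \<longleftrightarrow> y \<in> N"
      using x N by (metis subgroup.m_closed subgroup.m_inv_closed)+
  qed
  have "\<chi> (x \<otimes> y) = (\<chi> x + \<chi> y) mod 2" if "x \<in> carrier G" "y \<in> carrier G" for x y
    using that mixed[of x y] mixed[of y x] mult[of x y] by (auto simp: \<chi>_def)
  then have "\<chi> \<in> hom G (integer_mod_group 2)"
    by (auto simp: hom_def carrier_integer_mod_group \<chi>_def)
  then interpret \<chi>: group_hom G "integer_mod_group 2" \<chi>
    by (intro group_hom.intro group_hom_axioms.intro group_axioms group_integer_mod_group)
  have "\<chi> ` carrier G = carrier (integer_mod_group 2)"
  proof -
    have "\<chi> \<one> = 0" "\<chi> t = 1" using t N by (auto simp: \<chi>_def subgroup.one_closed)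
    moreover have "carrier (integer_mod_group 2) = {0, 1}"
      by (auto simp: carrier_integer_mod_group)
    ultimately show ?thesis
      using t(1) \<chi>.hom_closed by (metis empty_subsetI image_eqI image_subsetI insert_subset one_closed subset_antisym)
  qed
  moreover have "kernel G (integer_mod_group 2) \<chi> = N"
    using NG by (auto simp: kernel_def \<chi>_def)
  ultimately show ?thesis using \<chi>.FactGroup_iso_set is_isoI by metis
qed

end

lemma (in group_hom) normal_preimage:
  assumes N: "N \<lhd> H"
  shows "{x \<in> carrier G. h x \<in> N} \<lhd> G"
proof -
  note H.normal_invE[OF N]
  then show ?thesis
    by (intro G.normal_invI subgroup.intro)
      (auto simp: subgroup.m_closed subgroup.m_inv_closed subgroup.one_closed)
qed

section \<open>The regular representations and their normalizer\<close>

lemma Perm_apply_closed: "\<lbrakk>f \<in> carrier (BijGroup S); x \<in> S\<rbrakk> \<Longrightarrow> f x \<in> S"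
  by (auto simp: BijGroup_def dest: Bij_imp_funcset)

lemma Perm_mult_apply:
  "\<lbrakk>f \<in> carrier (BijGroup S); g \<in> carrier (BijGroup S); x \<in> S\<rbrakk>
    \<Longrightarrow> (f \<otimes>\<^bsub>BijGroup S\<^esub> g) x = f (g x)"
  by (simp add: BijGroup_def compose_def)

lemma Perm_one_apply: "x \<in> S \<Longrightarrow> \<one>\<^bsub>BijGroup S\<^esub> x = x"
  by (simp add: BijGroup_def)

lemma Perm_eqI:
  "\<lbrakk>f \<in> carrier (BijGroup S); g \<in> carrier (BijGroup S); \<And>x. x \<in> S \<Longrightarrow> f x = g x\<rbrakk> \<Longrightarrow> f = g"
  by (auto simp: BijGroup_def intro: extensionalityI dest: Bij_imp_extensional)

lemma Perm_iff:
  "f \<in> carrier (BijGroup S) \<longleftrightarrow> f \<in> extensional S \<and> bij_betw f S S"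
  by (simp add: BijGroup_def Bij_def)

lemma Perm_inv_apply:
  assumes "f \<in> carrier (BijGroup S)" "x \<in> S"
  shows "f ((inv\<^bsub>BijGroup S\<^esub> f) x) = x" "(inv\<^bsub>BijGroup S\<^esub> f) (f x) = x"
proof -
  interpret P: group "BijGroup S" by (rule group_BijGroup)
  show "f ((inv\<^bsub>BijGroup S\<^esub> f) x) = x" "(inv\<^bsub>BijGroup S\<^esub> f) (f x) = x"
    using assms by (metis P.inv_closed P.r_inv P.l_inv Perm_mult_apply Perm_one_apply)+
qed

context group
begin

interpretation P: group "Perm G" by (rule group_BijGroup)

lemma left_reg_in_Perm: "\<sigma> \<in> carrier G \<Longrightarrow> left_reg G \<sigma> \<in> carrier (Perm G)"
  unfolding Perm_iff left_reg_def
  by (auto intro!: bij_betw_byWitness[where f' = "\<lambda>x. inv \<sigma> \<otimes> x"] simp: group_word_simps)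

lemma right_reg_in_Perm: "\<sigma> \<in> carrier G \<Longrightarrow> right_reg G \<sigma> \<in> carrier (Perm G)"
  unfolding Perm_iff right_reg_def
  by (auto intro!: bij_betw_byWitness[where f' = "\<lambda>x. x \<otimes> \<sigma>"] simp: group_word_simps)

lemma left_reg_apply: "x \<in> carrier G \<Longrightarrow> left_reg G \<sigma> x = \<sigma> \<otimes> x"
  by (simp add: left_reg_def)

lemma right_reg_apply: "x \<in> carrier G \<Longrightarrow> right_reg G \<sigma> x = x \<otimes> inv \<sigma>"
  by (simp add: right_reg_def)

lemmas perm_simps = Perm_mult_apply Perm_apply_closed Perm_one_apply
  left_reg_in_Perm right_reg_in_Perm left_reg_apply right_reg_apply

lemma left_reg_hom: "left_reg G \<in> hom G (Perm G)"
  by (auto simp: hom_def perm_simps group_word_simps intro!: Perm_eqI[where S = "carrier G"])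

lemma right_reg_hom: "right_reg G \<in> hom G (Perm G)"
  by (auto simp: hom_def perm_simps group_word_simps intro!: Perm_eqI[where S = "carrier G"])

interpretation left_reg: group_hom G "Perm G" "left_reg G"
  by unfold_locales (rule left_reg_hom)

interpretation right_reg: group_hom G "Perm G" "right_reg G"
  by unfold_locales (rule right_reg_hom)

declare left_reg.hom_inv [simp del] right_reg.hom_inv [simp del]

lemma regular_left_reg: "regular_subgroup (left_reg G ` carrier G) G"
  unfolding regular_subgroup_def
proof
  show "bij_betw (\<lambda>\<eta>. \<eta> \<one>) (left_reg G ` carrier G) (carrier G)"
    by (rule bij_betw_byWitness[where f' = "left_reg G"]) (auto simp: left_reg_apply)
qed (rule left_reg.img_is_subgroup)

lemma regular_right_reg: "regular_subgroup (right_reg G ` carrier G) G"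
  unfolding regular_subgroup_def
proof
  show "bij_betw (\<lambda>\<eta>. \<eta> \<one>) (right_reg G ` carrier G) (carrier G)"
    by (rule bij_betw_byWitness[where f' = "\<lambda>x. right_reg G (inv x)"]) (auto simp: right_reg_apply)
qed (rule right_reg.img_is_subgroup)

lemma left_reg_iso: "left_reg G \<in> iso G ((Perm G)\<lparr>carrier := left_reg G ` carrier G\<rparr>)"
proof -
  have "inj_on (left_reg G) (carrier G)"
    by (rule inj_on_inverseI[where g = "\<lambda>\<eta>. \<eta> \<one>"]) (simp add: left_reg_apply)
  then show ?thesis
    using left_reg_hom by (auto simp: iso_def hom_def bij_betw_def)
qed

lemma right_reg_iso: "right_reg G \<in> iso G ((Perm G)\<lparr>carrier := right_reg G ` carrier G\<rparr>)"
proof -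
  have "inj_on (right_reg G) (carrier G)"
    by (rule inj_on_inverseI[where g = "\<lambda>\<eta>. inv (\<eta> \<one>)"]) (simp add: right_reg_apply)
  then show ?thesis
    using right_reg_hom by (auto simp: iso_def hom_def bij_betw_def)
qed

text \<open>A permutation that commutes with all left translations is determined by its value at \<open>1\<close>:
  \<open>f(x) = f(\<lambda>(x) 1) = x f(1)\<close>.\<close>

lemma centralizer_left_reg:
  "centralizer (Perm G) (left_reg G ` carrier G) = right_reg G ` carrier G"
proof (intro subset_antisym subsetI)
  fix f assume "f \<in> centralizer (Perm G) (left_reg G ` carrier G)"
  then have f: "f \<in> carrier (Perm G)"
    and comm: "\<And>\<sigma>. \<sigma> \<in> carrier G \<Longrightarrow>
      f \<otimes>\<^bsub>Perm G\<^esub> left_reg G \<sigma> = left_reg G \<sigma> \<otimes>\<^bsub>Perm G\<^esub> f"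
    by (auto simp: centralizer_def)
  have shift: "f x = x \<otimes> f \<one>" if "x \<in> carrier G" for x
    using fun_cong[OF comm[OF that], of \<one>] f that by (simp add: perm_simps)
  have f1: "f \<one> \<in> carrier G" using f by (simp add: Perm_apply_closed)
  have "f = right_reg G (inv (f \<one>))"
  proof (rule Perm_eqI[where S = "carrier G"])
    show "f x = right_reg G (inv (f \<one>)) x" if "x \<in> carrier G" for x
      using shift[OF that] f1 that by (simp add: perm_simps)
  qed (use f f1 in \<open>simp_all add: perm_simps\<close>)
  with f1 show "f \<in> right_reg G ` carrier G" using inv_closed by blast
next
  fix f assume "f \<in> right_reg G ` carrier G"
  then obtain \<tau> where \<tau>: "\<tau> \<in> carrier G" and f: "f = right_reg G \<tau>" by blast
  have "f \<otimes>\<^bsub>Perm G\<^esub> left_reg G \<sigma> = left_reg G \<sigma> \<otimes>\<^bsub>Perm G\<^esub> f" if "\<sigma> \<in> carrier G" for \<sigma>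
    using \<tau> that
    by (intro Perm_eqI[where S = "carrier G"]) (simp_all add: f perm_simps group_word_simps)
  then show "f \<in> centralizer (Perm G) (left_reg G ` carrier G)"
    using \<tau> by (auto simp: centralizer_def f perm_simps)
qed

lemma centralizer_right_reg:
  "centralizer (Perm G) (right_reg G ` carrier G) = left_reg G ` carrier G"
proof (intro subset_antisym subsetI)
  fix f assume "f \<in> centralizer (Perm G) (right_reg G ` carrier G)"
  then have f: "f \<in> carrier (Perm G)"
    and comm: "\<And>\<sigma>. \<sigma> \<in> carrier G \<Longrightarrow>
      f \<otimes>\<^bsub>Perm G\<^esub> right_reg G \<sigma> = right_reg G \<sigma> \<otimes>\<^bsub>Perm G\<^esub> f"
    by (auto simp: centralizer_def)
  have shift: "f x = f \<one> \<otimes> x" if "x \<in> carrier G" for x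
    using fun_cong[OF comm[of "inv x"], of \<one>] f that by (simp add: perm_simps)
  have f1: "f \<one> \<in> carrier G" using f by (simp add: Perm_apply_closed)
  have "f = left_reg G (f \<one>)"
  proof (rule Perm_eqI[where S = "carrier G"])
    show "f x = left_reg G (f \<one>) x" if "x \<in> carrier G" for x
      using shift[OF that] f1 that by (simp add: perm_simps)
  qed (use f f1 in \<open>simp_all add: perm_simps\<close>)
  with f1 show "f \<in> left_reg G ` carrier G" using inv_closed by blast
next
  fix f assume "f \<in> left_reg G ` carrier G"
  then obtain \<tau> where \<tau>: "\<tau> \<in> carrier G" and f: "f = left_reg G \<tau>" by blast
  have "f \<otimes>\<^bsub>Perm G\<^esub> right_reg G \<sigma> = right_reg G \<sigma> \<otimes>\<^bsub>Perm G\<^esub> f" if "\<sigma> \<in> carrier G" for \<sigma>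
    using \<tau> that
    by (intro Perm_eqI[where S = "carrier G"]) (simp_all add: f perm_simps group_word_simps)
  then show "f \<in> centralizer (Perm G) (right_reg G ` carrier G)"
    using \<tau> by (auto simp: centralizer_def f perm_simps)
qed

lemma auto_iff:
  "\<alpha> \<in> auto G \<longleftrightarrow> \<alpha> \<in> carrier (Perm G) \<and>
    (\<forall>x\<in>carrier G. \<forall>y\<in>carrier G. \<alpha> (x \<otimes> y) = \<alpha> x \<otimes> \<alpha> y)"
  by (auto simp: auto_def hom_def BijGroup_def dest: Bij_imp_funcset)

lemma auto_one:
  assumes "\<alpha> \<in> auto G" shows "\<alpha> \<one> = \<one>"
proof -
  have "\<alpha> \<in> hom G G" using assms by (simp add: auto_def)
  then show ?thesis using hom_one group_axioms by blast
qed

text \<open>The elements of the holomorph are the affine maps of \<open>G\<close>: a permutation is \<open>\<rho>(\<sigma>) \<circ> \<alpha>\<close> for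
  an automorphism \<open>\<alpha>\<close> if and only if \<open>x \<mapsto> f(x) f(1)\<inverse>\<close> is multiplicative. The identity below
  says this without naming \<open>\<sigma>\<close> and \<open>\<alpha>\<close>.\<close>

lemma Hol_iff:
  "f \<in> Hol G \<longleftrightarrow> f \<in> carrier (Perm G) \<and>
    (\<forall>x\<in>carrier G. \<forall>y\<in>carrier G. f (x \<otimes> y) = f x \<otimes> inv (f \<one>) \<otimes> f y)"
proof
  assume "f \<in> Hol G"
  then obtain \<sigma> \<alpha> where \<sigma>: "\<sigma> \<in> carrier G" and \<alpha>: "\<alpha> \<in> auto G"
    and f: "f = right_reg G \<sigma> \<otimes>\<^bsub>Perm G\<^esub> \<alpha>"
    by (auto simp: Hol_def set_mult_def)
  have \<alpha>P: "\<alpha> \<in> carrier (Perm G)" using \<alpha> by (simp add: auto_iff)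
  have fx: "f x = \<alpha> x \<otimes> inv \<sigma>" if "x \<in> carrier G" for x
    using that \<sigma> \<alpha>P by (simp add: f perm_simps)
  have "f (x \<otimes> y) = f x \<otimes> inv (f \<one>) \<otimes> f y" if "x \<in> carrier G" "y \<in> carrier G" for x y
  proof -
    have "\<alpha> x \<in> carrier G" "\<alpha> y \<in> carrier G" using that \<alpha>P by (auto simp: perm_simps)
    then have "\<alpha> x \<otimes> inv \<sigma> \<otimes> \<sigma> \<otimes> (\<alpha> y \<otimes> inv \<sigma>) = \<alpha> x \<otimes> \<alpha> y \<otimes> inv \<sigma>"
      using \<sigma> by (simp add: group_word_simps)
    then show ?thesis
      using that \<sigma> \<alpha> by (simp add: fx auto_one auto_iff)
  qed
  moreover have "f \<in> carrier (Perm G)"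
    unfolding f using \<sigma> \<alpha>P by (simp add: right_reg_in_Perm)
  ultimately show "f \<in> carrier (Perm G) \<and>
    (\<forall>x\<in>carrier G. \<forall>y\<in>carrier G. f (x \<otimes> y) = f x \<otimes> inv (f \<one>) \<otimes> f y)" by blast
next
  assume *: "f \<in> carrier (Perm G) \<and>
    (\<forall>x\<in>carrier G. \<forall>y\<in>carrier G. f (x \<otimes> y) = f x \<otimes> inv (f \<one>) \<otimes> f y)"
  then have f: "f \<in> carrier (Perm G)" and f1: "f \<one> \<in> carrier G" by (auto simp: perm_simps)
  define \<alpha> where "\<alpha> = right_reg G (f \<one>) \<otimes>\<^bsub>Perm G\<^esub> f"
  have \<alpha>: "\<alpha> \<in> carrier (Perm G)"
    unfolding \<alpha>_def using f f1 by (simp add: right_reg_in_Perm)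
  moreover have "\<alpha> (x \<otimes> y) = \<alpha> x \<otimes> \<alpha> y" if "x \<in> carrier G" "y \<in> carrier G" for x y
  proof -
    have "f x \<in> carrier G" "f y \<in> carrier G" using that f by (auto simp: perm_simps)
    then show ?thesis
      using that f f1 * by (simp add: \<alpha>_def perm_simps group_word_simps)
  qed
  ultimately have "\<alpha> \<in> auto G" by (simp add: auto_iff)
  moreover have "f = right_reg G (inv (f \<one>)) \<otimes>\<^bsub>Perm G\<^esub> \<alpha>"
    using f f1 \<alpha> by (intro Perm_eqI[where S = "carrier G"]) (auto simp: \<alpha>_def perm_simps group_word_simps)
  ultimately show "f \<in> Hol G"
    unfolding Hol_def set_mult_def using f1 by blast
qed

text \<open>If \<open>f\<close> conjugates \<open>\<lambda>(x)\<close> to \<open>\<lambda>(\<tau>)\<close>, then \<open>f(xz) = \<tau> f(z)\<close> for all \<open>z\<close>. The case \<open>z = 1\<close>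
  gives \<open>\<tau> = f(x) f(1)\<inverse>\<close>, so this is exactly the affine identity.\<close>

lemma normalizer_left_reg: "normalizer (Perm G) (left_reg G ` carrier G) = Hol G"
proof (intro subset_antisym subsetI)
  fix f assume "f \<in> normalizer (Perm G) (left_reg G ` carrier G)"
  then have f: "f \<in> carrier (Perm G)"
    and n: "\<And>\<sigma>. \<sigma> \<in> carrier G \<Longrightarrow>
      f \<otimes>\<^bsub>Perm G\<^esub> left_reg G \<sigma> \<otimes>\<^bsub>Perm G\<^esub> inv\<^bsub>Perm G\<^esub> f \<in> left_reg G ` carrier G"
    by (auto simp: P.normalizer_iff_conjugates left_reg.img_is_subgroup subgroup.subset)
  have f1: "f \<one> \<in> carrier G" using f by (simp add: perm_simps)
  have "f (x \<otimes> y) = f x \<otimes> inv (f \<one>) \<otimes> f y" if x: "x \<in> carrier G" and y: "y \<in> carrier G" for x y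
  proof -
    obtain \<tau> where \<tau>: "\<tau> \<in> carrier G"
      and eq: "f \<otimes>\<^bsub>Perm G\<^esub> left_reg G x \<otimes>\<^bsub>Perm G\<^esub> inv\<^bsub>Perm G\<^esub> f = left_reg G \<tau>"
      using n[OF x] by blast
    then have eq: "f \<otimes>\<^bsub>Perm G\<^esub> left_reg G x = left_reg G \<tau> \<otimes>\<^bsub>Perm G\<^esub> f"
      using f x by (simp add: P.eq_conjugate_iff left_reg_in_Perm)
    have shift: "f (x \<otimes> z) = \<tau> \<otimes> f z" if "z \<in> carrier G" for z
      using fun_cong[OF eq, of z] f x \<tau> that by (simp add: perm_simps)
    have "f x = \<tau> \<otimes> f \<one>" using shift[of \<one>] x by simp
    then have "\<tau> = f x \<otimes> inv (f \<one>)"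
      using f1 \<tau> by (simp add: group_word_simps)
    then show ?thesis using shift[OF y] by simp
  qed
  with f show "f \<in> Hol G" by (simp add: Hol_iff)
next
  fix f assume "f \<in> Hol G"
  then have f: "f \<in> carrier (Perm G)"
    and affine: "\<And>x y. \<lbrakk>x \<in> carrier G; y \<in> carrier G\<rbrakk> \<Longrightarrow> f (x \<otimes> y) = f x \<otimes> inv (f \<one>) \<otimes> f y"
    by (auto simp: Hol_iff)
  have f1: "f \<one> \<in> carrier G" using f by (simp add: perm_simps)
  have conj: "f \<otimes>\<^bsub>Perm G\<^esub> left_reg G \<sigma> = left_reg G (f \<sigma> \<otimes> inv (f \<one>)) \<otimes>\<^bsub>Perm G\<^esub> f"
    if "\<sigma> \<in> carrier G" for \<sigma>
    using that f f1 by (intro Perm_eqI[where S = "carrier G"]) (auto simp: perm_simps affine group_word_simps)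
  have "f \<otimes>\<^bsub>Perm G\<^esub> left_reg G \<sigma> \<otimes>\<^bsub>Perm G\<^esub> inv\<^bsub>Perm G\<^esub> f \<in> left_reg G ` carrier G"
    if \<sigma>: "\<sigma> \<in> carrier G" for \<sigma>
  proof -
    have c: "f \<sigma> \<otimes> inv (f \<one>) \<in> carrier G" using f f1 \<sigma> by (simp add: perm_simps)
    then have "f \<otimes>\<^bsub>Perm G\<^esub> left_reg G \<sigma> \<otimes>\<^bsub>Perm G\<^esub> inv\<^bsub>Perm G\<^esub> f
        = left_reg G (f \<sigma> \<otimes> inv (f \<one>))"
      using conj[OF \<sigma>] f \<sigma> by (subst P.eq_conjugate_iff) (auto simp: left_reg_in_Perm)
    then show ?thesis using c by blast
  qed
  moreover have "inv\<^bsub>Perm G\<^esub> f \<otimes>\<^bsub>Perm G\<^esub> left_reg G \<sigma> \<otimes>\<^bsub>Perm G\<^esub> f \<in> left_reg G ` carrier G"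
    if \<sigma>: "\<sigma> \<in> carrier G" for \<sigma>
  proof -
    \<comment> \<open>The solution of \<open>f(\<tau>) f(1)\<inverse> = \<sigma>\<close>, so that \<open>f\<close> conjugates \<open>\<lambda>(\<tau>)\<close> to \<open>\<lambda>(\<sigma>)\<close>.\<close>
    define \<tau> where "\<tau> = (inv\<^bsub>Perm G\<^esub> f) (\<sigma> \<otimes> f \<one>)"
    have \<tau>: "\<tau> \<in> carrier G" using f f1 \<sigma> by (simp add: \<tau>_def perm_simps)
    have "f \<tau> \<otimes> inv (f \<one>) = \<sigma>"
      using f f1 \<sigma> by (simp add: \<tau>_def Perm_inv_apply group_word_simps)
    then have "f \<otimes>\<^bsub>Perm G\<^esub> left_reg G \<tau> = left_reg G \<sigma> \<otimes>\<^bsub>Perm G\<^esub> f"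
      using conj[OF \<tau>] by simp
    then have "left_reg G \<tau> = inv\<^bsub>Perm G\<^esub> f \<otimes>\<^bsub>Perm G\<^esub> (left_reg G \<sigma> \<otimes>\<^bsub>Perm G\<^esub> f)"
      using f \<sigma> \<tau> by (simp add: P.inv_solve_left left_reg_in_Perm)
    then have "inv\<^bsub>Perm G\<^esub> f \<otimes>\<^bsub>Perm G\<^esub> left_reg G \<sigma> \<otimes>\<^bsub>Perm G\<^esub> f = left_reg G \<tau>"
      using f \<sigma> by (simp add: P.m_assoc left_reg_in_Perm)
    then show ?thesis using \<tau> by blast
  qed
  ultimately show "f \<in> normalizer (Perm G) (left_reg G ` carrier G)"
    using f by (simp add: P.normalizer_iff_conjugates left_reg.img_is_subgroup subgroup.subset)
qed

lemma normalizer_right_reg: "normalizer (Perm G) (right_reg G ` carrier G) = Hol G"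
  using P.normalizer_subset_normalizer_centralizer[of "left_reg G ` carrier G"]
    P.normalizer_subset_normalizer_centralizer[of "right_reg G ` carrier G"]
  by (simp add: centralizer_left_reg centralizer_right_reg normalizer_left_reg
      subgroup.subset[OF left_reg.img_is_subgroup] subgroup.subset[OF right_reg.img_is_subgroup]
      subset_antisym)

lemma subgroup_Hol: "subgroup (Hol G) (Perm G)"
  unfolding normalizer_left_reg[symmetric]
  by (intro P.normalizer_imp_subgroup subgroup.subset left_reg.img_is_subgroup)

lemma left_reg_in_Hol: "\<sigma> \<in> carrier G \<Longrightarrow> left_reg G \<sigma> \<in> Hol G"
  by (simp add: Hol_iff perm_simps group_word_simps)

lemma right_reg_in_Hol: "\<sigma> \<in> carrier G \<Longrightarrow> right_reg G \<sigma> \<in> Hol G"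
  by (simp add: Hol_iff perm_simps group_word_simps)

lemma left_reg_normal: "left_reg G ` carrier G \<lhd> (Perm G)\<lparr>carrier := Hol G\<rparr>"
  using P.subgroup_in_normalizer[OF left_reg.img_is_subgroup] by (simp add: normalizer_left_reg)

lemma right_reg_normal: "right_reg G ` carrier G \<lhd> (Perm G)\<lparr>carrier := Hol G\<rparr>"
  using P.subgroup_in_normalizer[OF right_reg.img_is_subgroup] by (simp add: normalizer_right_reg)

section \<open>Regular subgroups\<close>

lemma regular_subset_eq:
  assumes N: "regular_subgroup N G" and M: "regular_subgroup M G" and "N \<subseteq> M"
  shows "N = M"
proof
  show "M \<subseteq> N"
  proof
    fix m assume m: "m \<in> M"
    then have "m \<one> \<in> carrier G" using M by (auto simp: regular_subgroup_def bij_betw_def)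
    moreover have "(\<lambda>\<eta>. \<eta> \<one>) ` N = carrier G"
      using N by (simp add: regular_subgroup_def bij_betw_def)
    ultimately have "m \<one> \<in> (\<lambda>\<eta>. \<eta> \<one>) ` N" by simp
    then obtain n where n: "n \<in> N" "m \<one> = n \<one>" by (rule imageE)
    moreover have "inj_on (\<lambda>\<eta>. \<eta> \<one>) M"
      using M by (simp add: regular_subgroup_def bij_betw_def)
    ultimately have "m = n"
      using m \<open>N \<subseteq> M\<close> by (simp add: inj_on_def subset_eq)
    then show "m \<in> N" using n by simp
  qed
qed fact

text \<open>A regular group acts simply transitively from every base point \<open>u\<close>: if \<open>a \<in> N\<close> moves \<open>1\<close> to
  \<open>u\<close>, then evaluation at \<open>u\<close> is right translation by \<open>a\<close> followed by evaluation at \<open>1\<close>.\<close>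

lemma regular_bij_betw_apply:
  assumes N: "regular_subgroup N G" and u: "u \<in> carrier G"
  shows "bij_betw (\<lambda>\<eta>. \<eta> u) N (carrier G)"
proof -
  have sub: "subgroup N (Perm G)" and bij: "bij_betw (\<lambda>\<eta>. \<eta> \<one>) N (carrier G)"
    using N by (auto simp: regular_subgroup_def)
  have NP: "N \<subseteq> carrier (Perm G)" using sub by (rule subgroup.subset)
  have "u \<in> (\<lambda>\<eta>. \<eta> \<one>) ` N" using bij u by (simp add: bij_betw_def)
  then obtain a where a: "a \<in> N" "u = a \<one>" by (rule imageE)
  have "bij_betw (\<lambda>\<eta>. \<eta> \<otimes>\<^bsub>Perm G\<^esub> a) N N"
    using a NP sub
    by (intro bij_betw_byWitness[where f' = "\<lambda>\<eta>. \<eta> \<otimes>\<^bsub>Perm G\<^esub> inv\<^bsub>Perm G\<^esub> a"])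
      (auto simp: P.group_word_simps subset_eq subgroup.m_closed subgroup.m_inv_closed)
  note trans = bij_betw_trans[OF this bij]
  have eq: "((\<lambda>\<eta>. \<eta> \<one>) \<circ> (\<lambda>\<eta>. \<eta> \<otimes>\<^bsub>Perm G\<^esub> a)) \<eta> = \<eta> u" if "\<eta> \<in> N" for \<eta>
    using a NP that Perm_mult_apply[of \<eta> "carrier G" a \<one>] by auto
  show ?thesis using trans by (simp only: bij_betw_cong[OF eq])
qed

text \<open>Evaluating \<open>g n g\<inverse>\<close> at \<open>1\<close> amounts to evaluating \<open>n\<close> at the base point \<open>g\<inverse>(1)\<close> and
  applying the bijection \<open>g\<close>.\<close>

lemma regular_conjugate:
  assumes N: "regular_subgroup N G" and g: "g \<in> carrier (Perm G)"
  shows "regular_subgroup (g <#\<^bsub>Perm G\<^esub> N #>\<^bsub>Perm G\<^esub> inv\<^bsub>Perm G\<^esub> g) G"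
proof -
  let ?c = "\<lambda>n. g \<otimes>\<^bsub>Perm G\<^esub> n \<otimes>\<^bsub>Perm G\<^esub> inv\<^bsub>Perm G\<^esub> g"
  define u where "u = (inv\<^bsub>Perm G\<^esub> g) \<one>"
  have sub: "subgroup N (Perm G)" using N by (simp add: regular_subgroup_def)
  have NP: "N \<subseteq> carrier (Perm G)" using sub by (rule subgroup.subset)
  have u: "u \<in> carrier G" using g by (simp add: u_def Perm_apply_closed)
  have "bij_betw g (carrier G) (carrier G)" using g by (simp add: Perm_iff)
  with regular_bij_betw_apply[OF N u] have trans: "bij_betw (g \<circ> (\<lambda>\<eta>. \<eta> u)) N (carrier G)"
    by (rule bij_betw_trans)
  have eq: "(g \<circ> (\<lambda>\<eta>. \<eta> u)) n = ((\<lambda>\<eta>. \<eta> \<one>) \<circ> ?c) n" if "n \<in> N" for n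
    using g u NP that by (simp add: subset_eq perm_simps u_def)
  have "bij_betw ((\<lambda>\<eta>. \<eta> \<one>) \<circ> ?c) N (carrier G)"
    using trans by (simp only: bij_betw_cong[OF eq])
  then have "bij_betw (\<lambda>\<eta>. \<eta> \<one>) (?c ` N) (carrier G)"
    by (auto simp: bij_betw_def image_comp intro: inj_on_imageI)
  then show ?thesis
    using P.subgroup_conjugation_is_surj2[OF g sub]
    by (simp add: regular_subgroup_def P.conjugate_set_eq)
qed

section \<open>Inversion\<close>

definition inversion :: "'a \<Rightarrow> 'a" where
  "inversion = (\<lambda>x\<in>carrier G. inv x)"

lemma inversion_in_Perm: "inversion \<in> carrier (Perm G)"
  unfolding Perm_iff inversion_def
  by (auto intro!: bij_betw_byWitness[where f' = "\<lambda>x. inv x"])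

lemma inversion_apply: "x \<in> carrier G \<Longrightarrow> inversion x = inv x"
  by (simp add: inversion_def)

lemma inv_inversion: "inv\<^bsub>Perm G\<^esub> inversion = inversion"
  by (rule P.inv_equality)
    (auto simp: inversion_in_Perm perm_simps inversion_apply intro!: Perm_eqI[where S = "carrier G"])

text \<open>Conjugating an affine map \<open>h\<close> by inversion gives \<open>x \<mapsto> h(x\<inverse>)\<inverse>\<close>. Inversion reverses products
  twice, and the affine identity reads the same in both directions.\<close>

lemma inversion_in_NHol: "inversion \<in> NHol G"
proof -
  have "inversion \<otimes>\<^bsub>Perm G\<^esub> h \<otimes>\<^bsub>Perm G\<^esub> inversion \<in> Hol G" if h: "h \<in> Hol G" for h
  proof -
    let ?f = "inversion \<otimes>\<^bsub>Perm G\<^esub> h \<otimes>\<^bsub>Perm G\<^esub> inversion"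
    have hP: "h \<in> carrier (Perm G)" and affine: "\<And>x y. \<lbrakk>x \<in> carrier G; y \<in> carrier G\<rbrakk>
        \<Longrightarrow> h (x \<otimes> y) = h x \<otimes> inv (h \<one>) \<otimes> h y"
      using h by (auto simp: Hol_iff)
    have fx: "?f x = inv (h (inv x))" if "x \<in> carrier G" for x
      using that hP by (simp add: inversion_in_Perm perm_simps inversion_apply)
    have "?f (x \<otimes> y) = ?f x \<otimes> inv (?f \<one>) \<otimes> ?f y" if "x \<in> carrier G" "y \<in> carrier G" for x y
    proof -
      have "h (inv x) \<in> carrier G" "h (inv y) \<in> carrier G" "h \<one> \<in> carrier G"
        using that hP by (auto simp: perm_simps)
      moreover have "h (inv (x \<otimes> y)) = h (inv y) \<otimes> inv (h \<one>) \<otimes> h (inv x)"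
        using that affine[of "inv y" "inv x"] by (simp add: inv_mult_group)
      ultimately show ?thesis
        using that by (simp add: fx group_word_simps)
    qed
    then show ?thesis
      using hP by (simp add: Hol_iff inversion_in_Perm)
  qed
  then show ?thesis
    unfolding NHol_def P.normalizer_iff_conjugates[OF subgroup.subset[OF subgroup_Hol]]
    by (simp add: inv_inversion inversion_in_Perm)
qed

lemma inversion_in_Hol_imp_commute:
  assumes "inversion \<in> Hol G" and x: "x \<in> carrier G" and y: "y \<in> carrier G"
  shows "x \<otimes> y = y \<otimes> x"
proof -
  have "inv (inv x \<otimes> inv y) = x \<otimes> y"
    using assms(1) x y inversion_apply[of \<one>] inversion_apply[of "inv x"] inversion_apply[of "inv y"]
      inversion_apply[of "inv x \<otimes> inv y"]
    by (simp add: Hol_iff)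
  then show ?thesis
    using x y by (simp add: inv_mult_group)
qed

end

section \<open>Groups whose nontrivial normal subgroups meet\<close>

text \<open>The properties of an almost simple group on which the classification depends. Nontriviality
  has to be asked for, since the trivial group has the other two properties, but there
  \<open>NHol G = Hol G\<close>.\<close>

locale meeting_normals_group = group +
  assumes nontrivial: "carrier G \<noteq> {\<one>}"
    and centerless: "\<lbrakk>z \<in> carrier G; \<And>x. x \<in> carrier G \<Longrightarrow> z \<otimes> x = x \<otimes> z\<rbrakk> \<Longrightarrow> z = \<one>"
    and normals_meet: "\<lbrakk>A \<lhd> G; B \<lhd> G; A \<noteq> {\<one>}; B \<noteq> {\<one>}\<rbrakk> \<Longrightarrow> A \<inter> B \<noteq> {\<one>}"
begin

interpretation P: group "Perm G" by (rule group_BijGroup)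

interpretation Hol: group "(Perm G)\<lparr>carrier := Hol G\<rparr>"
  using subgroup_Hol by (rule P.subgroup_imp_group)

interpretation left_reg: group_hom G "(Perm G)\<lparr>carrier := Hol G\<rparr>" "left_reg G"
  using left_reg_hom left_reg_in_Hol by unfold_locales (auto simp: hom_def)

interpretation right_reg: group_hom G "(Perm G)\<lparr>carrier := Hol G\<rparr>" "right_reg G"
  using right_reg_hom right_reg_in_Hol by unfold_locales (auto simp: hom_def)

declare left_reg.hom_inv [simp del] right_reg.hom_inv [simp del]

text \<open>The core of the argument: either \<open>N\<close> centralizes one of the two regular representations, and
  then it is the other one, or it contains \<open>\<lambda>(s)\<close> and \<open>\<rho>(s)\<close> for a common \<open>s \<noteq> 1\<close>, which is too
  much for a group acting freely.\<close>

lemma normal_regular_subgroup_cases: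
  assumes N: "N \<lhd> (Perm G)\<lparr>carrier := Hol G\<rparr>" and reg: "regular_subgroup N G"
  shows "N = left_reg G ` carrier G \<or> N = right_reg G ` carrier G"
proof -
  let ?L = "left_reg G ` carrier G" and ?R = "right_reg G ` carrier G"
  have NP: "N \<subseteq> carrier (Perm G)"
    using reg by (simp add: regular_subgroup_def subgroup.subset)
  consider "N \<inter> ?L = {\<one>\<^bsub>Perm G\<^esub>}" | "N \<inter> ?R = {\<one>\<^bsub>Perm G\<^esub>}"
    | "N \<inter> ?L \<noteq> {\<one>\<^bsub>Perm G\<^esub>}" "N \<inter> ?R \<noteq> {\<one>\<^bsub>Perm G\<^esub>}" by blast
  then show ?thesis
  proof cases
    case 1
    then have "N \<subseteq> centralizer (Perm G) ?L"
      using Hol.disjoint_normals_commute[OF N left_reg_normal] NP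
      by (auto simp: centralizer_def)
    then show ?thesis
      using regular_subset_eq[OF reg regular_right_reg] by (simp add: centralizer_left_reg)
  next
    case 2
    then have "N \<subseteq> centralizer (Perm G) ?R"
      using Hol.disjoint_normals_commute[OF N right_reg_normal] NP
      by (auto simp: centralizer_def)
    then show ?thesis
      using regular_subset_eq[OF reg regular_left_reg] by (simp add: centralizer_right_reg)
  next
    case 3
    let ?A = "{s \<in> carrier G. left_reg G s \<in> N}" and ?B = "{s \<in> carrier G. right_reg G s \<in> N}"
    have one: "\<one>\<^bsub>Perm G\<^esub> \<in> N"
      using reg by (simp add: regular_subgroup_def subgroup.one_closed)
    have "N \<inter> ?L = left_reg G ` ?A" "N \<inter> ?R = right_reg G ` ?B" by blast+
    then have "?A \<noteq> {\<one>}" "?B \<noteq> {\<one>}"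
      using 3 left_reg.hom_one right_reg.hom_one by force+
    then have "?A \<inter> ?B \<noteq> {\<one>}"
      by (rule normals_meet[OF left_reg.normal_preimage[OF N] right_reg.normal_preimage[OF N]])
    moreover have "\<one> \<in> ?A \<inter> ?B"
      using one left_reg.hom_one right_reg.hom_one by auto
    ultimately obtain s where s: "s \<in> carrier G" "s \<noteq> \<one>" "left_reg G s \<in> N" "right_reg G s \<in> N"
      by blast
    have "right_reg G (inv s) \<in> N"
      using s normal_imp_subgroup[OF N] right_reg.hom_inv by (simp add: subgroup.m_inv_closed)
    moreover have "left_reg G s \<one> = right_reg G (inv s) \<one>"
      using s by (simp add: left_reg_apply right_reg_apply)
    moreover have "inj_on (\<lambda>\<eta>. \<eta> \<one>) N"
      using reg by (simp add: regular_subgroup_def bij_betw_def)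
    ultimately have "left_reg G s = right_reg G (inv s)"
      using s(3) by (simp add: inj_on_def)
    from fun_cong[OF this] have "s \<otimes> x = x \<otimes> s" if "x \<in> carrier G" for x
      using s(1) that left_reg_apply[OF that, of s] right_reg_apply[OF that, of "inv s"] by simp
    then show ?thesis using centerless s by blast
  qed
qed

lemma H1_eq: "H1 G = {left_reg G ` carrier G, right_reg G ` carrier G}"
  using normal_regular_subgroup_cases left_reg_normal right_reg_normal
    regular_left_reg regular_right_reg
  by (auto simp: H1_def)

lemma H0_eq: "H0 G = {left_reg G ` carrier G, right_reg G ` carrier G}"
proof
  show "H0 G \<subseteq> {left_reg G ` carrier G, right_reg G ` carrier G}"
  proof
    fix N assume "N \<in> H0 G"
    then have N: "regular_subgroup N G" "normalizer (Perm G) N = Hol G"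
      by (auto simp: H0_def)
    then have "N \<lhd> (Perm G)\<lparr>carrier := Hol G\<rparr>"
      using P.subgroup_in_normalizer[of N] by (simp add: regular_subgroup_def)
    with N show "N \<in> {left_reg G ` carrier G, right_reg G ` carrier G}"
      using normal_regular_subgroup_cases by blast
  qed
  have "(Perm G)\<lparr>carrier := left_reg G ` carrier G\<rparr> \<cong> G"
    "(Perm G)\<lparr>carrier := right_reg G ` carrier G\<rparr> \<cong> G"
    using left_reg_iso right_reg_iso iso_sym is_isoI by blast+
  then show "{left_reg G ` carrier G, right_reg G ` carrier G} \<subseteq> H0 G"
    by (simp add: H0_def regular_left_reg regular_right_reg normalizer_left_reg normalizer_right_reg)
qed

text \<open>Such a \<open>g\<close> permutes the normal regular subgroups of \<open>Hol G\<close> by conjugation. It fixes neither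
  of the two, as either one has \<open>Hol G\<close> for its normalizer.\<close>

lemma NHol_swaps:
  assumes g: "g \<in> NHol G" "g \<notin> Hol G"
  shows "g <#\<^bsub>Perm G\<^esub> (left_reg G ` carrier G) #>\<^bsub>Perm G\<^esub> inv\<^bsub>Perm G\<^esub> g = right_reg G ` carrier G"
    and "g <#\<^bsub>Perm G\<^esub> (right_reg G ` carrier G) #>\<^bsub>Perm G\<^esub> inv\<^bsub>Perm G\<^esub> g = left_reg G ` carrier G"
proof -
  let ?L = "left_reg G ` carrier G" and ?R = "right_reg G ` carrier G"
  have gP: "g \<in> carrier (Perm G)"
    using g(1) by (simp add: NHol_def P.normalizer_iff_conjugates[OF subgroup.subset[OF subgroup_Hol]])
  have cases: "g <#\<^bsub>Perm G\<^esub> N #>\<^bsub>Perm G\<^esub> inv\<^bsub>Perm G\<^esub> g \<in> {?L, ?R}"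
    if "N \<lhd> (Perm G)\<lparr>carrier := Hol G\<rparr>" "regular_subgroup N G" for N
    using normal_regular_subgroup_cases[OF P.normal_in_conjugate[OF subgroup_Hol that(1)]
        regular_conjugate[OF that(2) gP]] g(1) by (simp add: NHol_def)
  have "?L \<subseteq> carrier (Perm G)" "?R \<subseteq> carrier (Perm G)"
    by (auto simp: left_reg_in_Perm right_reg_in_Perm)
  from this[THEN P.normalizer_iff_conjugate_set, of g]
  have "g <#\<^bsub>Perm G\<^esub> ?L #>\<^bsub>Perm G\<^esub> inv\<^bsub>Perm G\<^esub> g \<noteq> ?L"
    "g <#\<^bsub>Perm G\<^esub> ?R #>\<^bsub>Perm G\<^esub> inv\<^bsub>Perm G\<^esub> g \<noteq> ?R"
    using g(2) gP by (simp_all add: normalizer_left_reg normalizer_right_reg)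
  then show "g <#\<^bsub>Perm G\<^esub> ?L #>\<^bsub>Perm G\<^esub> inv\<^bsub>Perm G\<^esub> g = ?R"
    "g <#\<^bsub>Perm G\<^esub> ?R #>\<^bsub>Perm G\<^esub> inv\<^bsub>Perm G\<^esub> g = ?L"
    using cases[OF left_reg_normal regular_left_reg] cases[OF right_reg_normal regular_right_reg]
    by blast+
qed

lemma T_group_iso: "T_group G \<cong> integer_mod_group 2"
proof -
  have HolP: "Hol G \<subseteq> carrier (Perm G)" by (rule subgroup.subset[OF subgroup_Hol])
  have subN: "subgroup (NHol G) (Perm G)"
    unfolding NHol_def by (rule P.normalizer_imp_subgroup[OF HolP])
  interpret NHol: group "(Perm G)\<lparr>carrier := NHol G\<rparr>"
    using subN by (rule P.subgroup_imp_group)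
  have "Hol G \<lhd> (Perm G)\<lparr>carrier := NHol G\<rparr>"
    unfolding NHol_def by (rule P.subgroup_in_normalizer[OF subgroup_Hol])
  then have "subgroup (Hol G) ((Perm G)\<lparr>carrier := NHol G\<rparr>)"
    by (rule normal_imp_subgroup)
  moreover have "inversion \<notin> Hol G"
  proof
    assume "inversion \<in> Hol G"
    then have "z = \<one>" if "z \<in> carrier G" for z
      using centerless inversion_in_Hol_imp_commute that by blast
    then show False using nontrivial by blast
  qed
  moreover have "x \<otimes>\<^bsub>Perm G\<^esub> y \<in> Hol G" if x: "x \<in> NHol G - Hol G" and y: "y \<in> NHol G - Hol G" for x y
  proof -
    have P: "x \<in> carrier (Perm G)" "y \<in> carrier (Perm G)"
      using x y subgroup.subset[OF subN] by auto
    have L: "left_reg G ` carrier G \<subseteq> carrier (Perm G)" by (auto simp: left_reg_in_Perm)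
    have "x \<otimes>\<^bsub>Perm G\<^esub> y \<in> normalizer (Perm G) (left_reg G ` carrier G)"
      unfolding P.normalizer_iff_conjugate_set[OF L] P.conjugate_set_mult[OF P L]
      using NHol_swaps x y P by simp
    then show ?thesis by (simp add: normalizer_left_reg)
  qed
  ultimately show ?thesis
    unfolding T_group_def using inversion_in_NHol
    by (intro NHol.quotient_iso_integer_mod_2[of _ inversion]) auto
qed

end

section \<open>Almost simple groups\<close>

lemma (in simple_group) nonabelian_centerless:
  assumes noncomm: "\<not> comm_group G" and z: "z \<in> carrier G"
    and central: "\<And>x. x \<in> carrier G \<Longrightarrow> z \<otimes> x = x \<otimes> z"
  shows "z = \<one>"
proof -
  define Z where "Z = centralizer G (carrier G)"
  have Z_iff: "a \<in> Z \<longleftrightarrow> a \<in> carrier G \<and> (\<forall>x\<in>carrier G. a \<otimes> x = x \<otimes> a)" for a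
    by (simp add: Z_def centralizer_def)
  have "Z \<lhd> G"
  proof (rule normal_invI)
    show "subgroup Z G"
    proof
      show "a \<otimes> b \<in> Z" if "a \<in> Z" "b \<in> Z" for a b
      proof -
        have ab: "a \<in> carrier G" "b \<in> carrier G" using that by (auto simp: Z_iff)
        have "a \<otimes> b \<otimes> x = x \<otimes> (a \<otimes> b)" if x: "x \<in> carrier G" for x
        proof -
          have "a \<otimes> x = x \<otimes> a" "b \<otimes> x = x \<otimes> b" using \<open>a \<in> Z\<close> \<open>b \<in> Z\<close> x Z_iff by blast+
          then show ?thesis using ab x by (metis m_assoc)
        qed
        then show ?thesis using ab by (simp add: Z_iff)
      qed
      show "inv a \<in> Z" if "a \<in> Z" for a
      proof -
        have a: "a \<in> carrier G" using that by (simp add: Z_iff)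
        have "inv a \<otimes> x = x \<otimes> inv a" if x: "x \<in> carrier G" for x
        proof -
          have "inv a \<otimes> x = inv a \<otimes> (x \<otimes> a) \<otimes> inv a" using a x by (simp add: m_assoc)
          also have "x \<otimes> a = a \<otimes> x" using \<open>a \<in> Z\<close> x Z_iff by metis
          finally show ?thesis using a x by (simp add: cancel_left)
        qed
        then show ?thesis using a by (simp add: Z_iff)
      qed
    qed (auto simp: Z_iff)
    show "x \<otimes> h \<otimes> inv x \<in> Z" if "x \<in> carrier G" "h \<in> Z" for x h
    proof -
      have "x \<otimes> h \<otimes> inv x = h"
        using that Z_iff eq_conjugate_iff by metis
      then show ?thesis using that by simp
    qed
  qed
  moreover have "Z \<noteq> carrier G"
  proof
    assume "Z = carrier G"
    then have "comm_group G"
      by (intro group_comm_groupI) (use Z_iff in blast)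
    then show False using noncomm by simp
  qed
  ultimately have "Z = {\<one>}" using no_real_normal_subgroup by blast
  then show ?thesis using z central Z_iff by blast
qed

text \<open>Let \<open>e\<close> embed \<open>T\<close> as a normal subgroup of \<open>G\<close> with trivial centralizer. A nontrivial element
  \<open>a\<close> of a normal subgroup \<open>A\<close> fails to commute with some \<open>e(u)\<close>. The commutator of \<open>a\<close> and
  \<open>e(u)\<close> is a nontrivial element of \<open>A\<close> in the image of \<open>e\<close>, and as \<open>T\<close> is simple all of \<open>e(T)\<close>
  lies in \<open>A\<close>.\<close>

lemma (in group) meeting_normals_of_embedded_simple:
  fixes T :: "('c, 'd) monoid_scheme"
  assumes T: "simple_group T" and e: "e \<in> hom T G" and inj: "inj_on e (carrier T)"
    and conj: "\<And>g t. \<lbrakk>g \<in> carrier G; t \<in> carrier T\<rbrakk> \<Longrightarrow>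
      \<exists>t'\<in>carrier T. g \<otimes> e t = e t' \<otimes> g"
    and cent: "\<And>g. \<lbrakk>g \<in> carrier G; \<And>t. t \<in> carrier T \<Longrightarrow> g \<otimes> e t = e t \<otimes> g\<rbrakk> \<Longrightarrow> g = \<one>"
  shows "meeting_normals_group G"
proof -
  interpret T: simple_group T by fact
  interpret e: group_hom T G e by unfold_locales fact
  obtain x where x: "x \<in> carrier T" "x \<noteq> \<one>\<^bsub>T\<^esub>"
    using T.simple_not_triv T.one_closed by blast
  have ex: "e x \<noteq> \<one>" "e x \<in> carrier G"
    using x inj_on_eq_iff[OF inj x(1) T.one_closed] by auto
  have contains: "e t \<in> A" if A: "A \<lhd> G" "A \<noteq> {\<one>}" and t: "t \<in> carrier T" for A t
  proof -
    have subA: "subgroup A G" using A(1) by (rule normal_imp_subgroup)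
    obtain a where a: "a \<in> A" "a \<noteq> \<one>"
      using A(2) subgroup.one_closed[OF subA] by blast
    have aG: "a \<in> carrier G" using a subgroup.subset[OF subA] by blast
    obtain u where u: "u \<in> carrier T" "a \<otimes> e u \<noteq> e u \<otimes> a"
      using cent[OF aG] a(2) by blast
    obtain v where v: "v \<in> carrier T" "a \<otimes> e u = e v \<otimes> a"
      using conj[OF aG u(1)] by blast
    have "v \<noteq> u" using u v by auto
    then have c: "v \<otimes>\<^bsub>T\<^esub> inv\<^bsub>T\<^esub> u \<noteq> \<one>\<^bsub>T\<^esub>"
      using u(1) v(1) T.inv_solve_right'[of "\<one>\<^bsub>T\<^esub>" v u] by auto
    have "e (v \<otimes>\<^bsub>T\<^esub> inv\<^bsub>T\<^esub> u) = a \<otimes> e u \<otimes> inv a \<otimes> inv e u"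
      unfolding v(2) using aG u v by (simp add: group_word_simps)
    also have "\<dots> = a \<otimes> (e u \<otimes> inv a \<otimes> inv e u)"
      using aG u by (simp add: m_assoc)
    also have "\<dots> \<in> A"
      using a(1) u normal_invE[OF A(1)] by (simp add: subgroup.m_closed subgroup.m_inv_closed)
    finally have "v \<otimes>\<^bsub>T\<^esub> inv\<^bsub>T\<^esub> u \<in> {t \<in> carrier T. e t \<in> A}" using u v by simp
    then have "{t \<in> carrier T. e t \<in> A} \<noteq> {\<one>\<^bsub>T\<^esub>}" using c by blast
    then have "{t \<in> carrier T. e t \<in> A} = carrier T"
      using T.no_real_normal_subgroup[OF e.normal_preimage[OF A(1)]] by blast
    then show ?thesis using t by blast
  qed
  show ?thesis
  proof
    show "carrier G \<noteq> {\<one>}" using ex by blast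
    show "z = \<one>" if "z \<in> carrier G" "\<And>x. x \<in> carrier G \<Longrightarrow> z \<otimes> x = x \<otimes> z" for z
      using cent[OF that(1)] that(2) e.hom_closed by blast
    show "A \<inter> B \<noteq> {\<one>}" if "A \<lhd> G" "B \<lhd> G" "A \<noteq> {\<one>}" "B \<noteq> {\<one>}" for A B
      using contains[OF that(1,3) x(1)] contains[OF that(2,4) x(1)] ex by blast
  qed
qed

text \<open>The embedding of \<open>T\<close> sends \<open>t\<close> to the element of \<open>G\<close> that corresponds to the inner
  automorphism of \<open>t\<close>; it is injective because \<open>T\<close> has trivial centre. From
  \<open>\<alpha> \<circ> inn(t) = inn(\<alpha>(t)) \<circ> \<alpha>\<close> for automorphisms \<open>\<alpha>\<close> it follows both that the image is normal
  and that an automorphism commuting with all inner ones fixes every \<open>t\<close>.\<close>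

lemma almost_simple_meeting_normals:
  fixes G :: "('a, 'c) monoid_scheme" and T :: "('b, 'd) monoid_scheme"
  assumes "almost_simple_over T G"
  shows "meeting_normals_group G"
proof -
  interpret G: group G using assms by (simp add: almost_simple_over_def)
  interpret T: simple_group T using assms by (simp add: almost_simple_over_def)
  have noncomm: "\<not> comm_group T" using assms by (simp add: almost_simple_over_def)
  obtain K \<phi> where K: "subgroup K (AutoGroup T)" "Inn T \<subseteq> K"
    and \<phi>: "\<phi> \<in> iso G (AutoGroup T\<lparr>carrier := K\<rparr>)"
    using assms by (auto simp: almost_simple_over_def is_iso_def)
  interpret P: group "Perm T" by (rule group_BijGroup)
  have Kaut: "K \<subseteq> auto T" using subgroup.subset[OF K(1)] by (simp add: AutoGroup_def)
  have \<phi>_bij: "bij_betw \<phi> (carrier G) K" using \<phi> by (simp add: iso_def)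
  have \<phi>_aut: "\<phi> g \<in> auto T" if "g \<in> carrier G" for g
    using that \<phi>_bij Kaut by (auto simp: bij_betw_def)
  then have \<phi>_Perm: "\<phi> g \<in> carrier (Perm T)" if "g \<in> carrier G" for g
    using that by (simp add: T.auto_iff)
  have \<phi>_mult: "\<phi> (g \<otimes>\<^bsub>G\<^esub> h) = \<phi> g \<otimes>\<^bsub>Perm T\<^esub> \<phi> h" if "g \<in> carrier G" "h \<in> carrier G" for g h
    using \<phi> that by (simp add: iso_def hom_def AutoGroup_def)
  have \<phi>_inj: "g = h" if "\<phi> g = \<phi> h" "g \<in> carrier G" "h \<in> carrier G" for g h
    using that \<phi>_bij by (auto simp: bij_betw_def dest: inj_onD)
  define inn where "inn t = (\<lambda>x\<in>carrier T. t \<otimes>\<^bsub>T\<^esub> x \<otimes>\<^bsub>T\<^esub> inv\<^bsub>T\<^esub> t)" for t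
  have inn_K: "inn t \<in> K" if "t \<in> carrier T" for t
    using that K(2) by (auto simp: Inn_def inn_def)
  have inn_Perm: "inn t \<in> carrier (Perm T)" if "t \<in> carrier T" for t
    using inn_K[OF that] Kaut by (auto simp: T.auto_iff)
  have inn_apply: "inn t x = t \<otimes>\<^bsub>T\<^esub> x \<otimes>\<^bsub>T\<^esub> inv\<^bsub>T\<^esub> t" if "x \<in> carrier T" for t x
    using that by (simp add: inn_def)
  have inn_mult: "inn (s \<otimes>\<^bsub>T\<^esub> t) = inn s \<otimes>\<^bsub>Perm T\<^esub> inn t" if "s \<in> carrier T" "t \<in> carrier T" for s t
    using that inn_Perm
    by (intro Perm_eqI[where S = "carrier T"])
      (auto simp: Perm_mult_apply inn_apply T.group_word_simps)
  have inn_inj: "s = t" if "inn s = inn t" and s: "s \<in> carrier T" and t: "t \<in> carrier T" for s t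
  proof -
    have "inv\<^bsub>T\<^esub> t \<otimes>\<^bsub>T\<^esub> s \<otimes>\<^bsub>T\<^esub> x = x \<otimes>\<^bsub>T\<^esub> (inv\<^bsub>T\<^esub> t \<otimes>\<^bsub>T\<^esub> s)" if x: "x \<in> carrier T" for x
    proof -
      have "s \<otimes>\<^bsub>T\<^esub> x \<otimes>\<^bsub>T\<^esub> inv\<^bsub>T\<^esub> s = t \<otimes>\<^bsub>T\<^esub> x \<otimes>\<^bsub>T\<^esub> inv\<^bsub>T\<^esub> t"
        using fun_cong[OF \<open>inn s = inn t\<close>, of x] x by (simp add: inn_apply)
      then have "s \<otimes>\<^bsub>T\<^esub> x = t \<otimes>\<^bsub>T\<^esub> x \<otimes>\<^bsub>T\<^esub> inv\<^bsub>T\<^esub> t \<otimes>\<^bsub>T\<^esub> s"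
        using s t x by (simp add: T.eq_conjugate_iff)
      then have "inv\<^bsub>T\<^esub> t \<otimes>\<^bsub>T\<^esub> (s \<otimes>\<^bsub>T\<^esub> x) = x \<otimes>\<^bsub>T\<^esub> (inv\<^bsub>T\<^esub> t \<otimes>\<^bsub>T\<^esub> s)"
        using s t x by (simp add: T.group_word_simps)
      then show ?thesis using s t x by (simp add: T.m_assoc)
    qed
    then have "inv\<^bsub>T\<^esub> t \<otimes>\<^bsub>T\<^esub> s = \<one>\<^bsub>T\<^esub>"
      using T.nonabelian_centerless[OF noncomm] s t by simp
    then show ?thesis using s t by (metis T.inv_closed T.inv_equality T.inv_inv)
  qed
  have twist: "\<alpha> \<otimes>\<^bsub>Perm T\<^esub> inn t = inn (\<alpha> t) \<otimes>\<^bsub>Perm T\<^esub> \<alpha>"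
    if \<alpha>: "\<alpha> \<in> auto T" and t: "t \<in> carrier T" for \<alpha> t
  proof (rule Perm_eqI[where S = "carrier T"])
    have \<alpha>P: "\<alpha> \<in> carrier (Perm T)" using \<alpha> by (simp add: T.auto_iff)
    then have \<alpha>t: "\<alpha> t \<in> carrier T" using t by (simp add: Perm_apply_closed)
    interpret \<alpha>: group_hom T T \<alpha> using \<alpha> by unfold_locales (simp add: auto_def)
    show "\<alpha> \<otimes>\<^bsub>Perm T\<^esub> inn t \<in> carrier (Perm T)" "inn (\<alpha> t) \<otimes>\<^bsub>Perm T\<^esub> \<alpha> \<in> carrier (Perm T)"
      using \<alpha>P \<alpha>t t inn_Perm by auto
    show "(\<alpha> \<otimes>\<^bsub>Perm T\<^esub> inn t) x = (inn (\<alpha> t) \<otimes>\<^bsub>Perm T\<^esub> \<alpha>) x" if "x \<in> carrier T" for x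
      using \<alpha>P \<alpha>t t inn_Perm that by (simp add: Perm_mult_apply inn_apply)
  qed
  define e where "e t = inv_into (carrier G) \<phi> (inn t)" for t
  have e_closed: "e t \<in> carrier G" and \<phi>e: "\<phi> (e t) = inn t" if "t \<in> carrier T" for t
    using inn_K[OF that] \<phi>_bij unfolding e_def bij_betw_def
    by (auto intro: inv_into_into f_inv_into_f)
  have \<phi>g_closed: "\<phi> g t \<in> carrier T" if "g \<in> carrier G" "t \<in> carrier T" for g t
    using that \<phi>_Perm by (simp add: Perm_apply_closed)
  have twist_e: "g \<otimes>\<^bsub>G\<^esub> e t = e (\<phi> g t) \<otimes>\<^bsub>G\<^esub> g" if "g \<in> carrier G" "t \<in> carrier T" for g t
    using that e_closed \<phi>g_closed twist[OF \<phi>_aut]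
    by (intro \<phi>_inj) (simp_all add: \<phi>_mult \<phi>e)
  show ?thesis
  proof (rule G.meeting_normals_of_embedded_simple[where e = e])
    show "simple_group T" by unfold_locales
    show "e \<in> hom T G"
    proof (rule homI)
      show "e (s \<otimes>\<^bsub>T\<^esub> t) = e s \<otimes>\<^bsub>G\<^esub> e t" if "s \<in> carrier T" "t \<in> carrier T" for s t
        using that e_closed by (intro \<phi>_inj) (simp_all add: \<phi>_mult \<phi>e inn_mult)
    qed (rule e_closed)
    show "inj_on e (carrier T)"
      by (rule inj_onI) (metis \<phi>e inn_inj)
    show "\<exists>t'\<in>carrier T. g \<otimes>\<^bsub>G\<^esub> e t = e t' \<otimes>\<^bsub>G\<^esub> g" if "g \<in> carrier G" "t \<in> carrier T" for g t
      using twist_e \<phi>g_closed that by blast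
    show "g = \<one>\<^bsub>G\<^esub>" if g: "g \<in> carrier G"
      and comm: "\<And>t. t \<in> carrier T \<Longrightarrow> g \<otimes>\<^bsub>G\<^esub> e t = e t \<otimes>\<^bsub>G\<^esub> g" for g
    proof -
      have "\<phi> g t = t" if t: "t \<in> carrier T" for t
      proof -
        have "e (\<phi> g t) \<otimes>\<^bsub>G\<^esub> g = e t \<otimes>\<^bsub>G\<^esub> g" using twist_e[OF g t] comm[OF t] by simp
        then have "e (\<phi> g t) = e t" using g t e_closed \<phi>g_closed by simp
        then show ?thesis using \<phi>e inn_inj \<phi>g_closed g t by metis
      qed
      \<comment> \<open>\<open>\<phi>(g)\<close> is the identity map, so \<open>g\<close> is idempotent and hence trivial.\<close>
      then have "\<phi> (g \<otimes>\<^bsub>G\<^esub> g) = \<phi> g"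
        using g \<phi>_Perm by (intro Perm_eqI[where S = "carrier T"]) (auto simp: \<phi>_mult Perm_mult_apply)
      then have "g \<otimes>\<^bsub>G\<^esub> g = g" using g by (intro \<phi>_inj) auto
      then show ?thesis using g by (metis G.l_cancel_one')
    qed
  qed
qed

theorem theorem1p2:
  fixes G :: "('a, 'c) monoid_scheme" and T :: "('b, 'd) monoid_scheme"
  assumes "finite (carrier G)"
    and "almost_simple_over T G"
  shows "H1 G = {left_reg G ` carrier G, right_reg G ` carrier G} \<and>
         H0 G = {left_reg G ` carrier G, right_reg G ` carrier G} \<and>
         T_group G \<cong> integer_mod_group 2"
proof -
  interpret meeting_normals_group G
    using assms(2) by (rule almost_simple_meeting_normals)
  show ?thesis using H1_eq H0_eq T_group_iso by blast
qed

end
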